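(* Consider the three-dimensional curvilinear DGSEM semi-discretization of the compressible Euler equations with gravity for the set of conserved variables $(\varrho,\varrho\vec V,\varrho E)$ or $(\varrho,\varrho\vec V,\varrho\theta)$. The numerical non-conservative surface and volume fluxes and numerical conservative surface and volume fluxes are kinetic and potential energy preserving (KPEP) if (i) the numerical density flux and the non-conservative fluxes are of the form $$\vec f^{\varrho,*}=\vec f^{\varrho,\mathrm{vol}}=\overline\varrho\,\{\!\{\vec V\}\!\},\qquad \vec g^{\varrho\vec V,*}=\vec g^{\varrho\vec V,\mathrm{vol}}=\overline\varrho\,[\![\phi]\!]$$ with the same mean value $\overline\varrho$; and (ii) the numerical volume and surface fluxes are kinetic energy preserving (KEP).
   Context: Mass and momentum equations: $\partial_t\varrho+\nabla\cdot(\varrho\vec V)=0$, $\partial_t(\varrho\vec V)+\nabla\cdot(\varrho\vec V\otimes\vec V)+\nabla p+\varrho\nabla\phi=0$, $\vec V=(v_1,v_2,v_3)$, $\varrho>0$, time-independent geopotential $\phi(x,y,z)$; the system is closed by an equation for $\varrho E=\frac p{\gamma-1}+\frac12\varrho\|\vec V\|^2$ or for $\varrho\theta$ with $p=K(\varrho\theta)^\gamma$. For an ordered pair of nodes with values $a_-$ (first), $a_+$ (second): $\{\!\{a\}\!\}=(a_-+a_+)/2$, $[\![a]\!]=a_+-a_-$. $\overline\varrho$ is a symmetric two-point mean of the density with $\overline\varrho=\varrho$ if both densities equal $\varrho$. Two-point fluxes $f^d$ in the Cartesian directions $d=1,2,3$ are symmetric and consistent; KEP means $f^d_{\varrho v_c}=\{\!\{v_c\}\!\}f^d_\varrho+\delta_{cd}\{\!\{p\}\!\}$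 for $c,d=1,2,3$. The two-point non-conservative term in direction $d$ has zero mass component and momentum component $c$ equal to $\delta_{cd}\,\overline\varrho\,[\![\phi]\!]$. Write $\overset{\leftrightarrow}f=(f^1,f^2,f^3)$, $\overset{\leftrightarrow}f\cdot\vec a=\sum_da_df^d$, similarly for $g$. DGSEM: on each hexahedral element mapped from $[-1,1]^3$, with tensor-product Lobatto–Gauss–Legendre nodes $(i,j,k)\in\{0,\dots,N\}^3$, 1D weights $\omega_i$, $\omega_{ij}=\omega_i\omega_j$, $\omega_{ijk}=\omega_i\omega_j\omega_k$, Lagrange derivative matrix $D_{ij}=l_j'(\xi_i)$, $Q_{ij}=\omega_iD_{ij}$ ($Q+Q^T=\mathrm{diag}(-1,0,\dots,0,1)$, $\sum_jQ_{ij}=0$), mapping Jacobian $J_{ijk}>0$ and contravariant metric vectors $J\vec a^1,J\vec a^2,J\vec a^3\in\mathbb R^3$ at the nodes, the scheme is $J_{ijk}\omega_{ijk}\dot u_{ijk}=\mathcal F^1_{ijk}+\mathcal F^2_{ijk}+\mathcal F^3_{ijk}$ with $$\mathcal F^1_{ijk}=\omega_{jk}\Big(-2\sum_mQ_{im}\tilde f^{1,\mathrm{vol}}_{(i,m)jk}-\sum_mQ_{im}\tilde g^{1,\mathrm{vol}}_{(i,m)jk}-\delta_{i0}[\overset{\leftrightarrow}f\cdot J\vec a^1]_{0jk}+\delta_{iN}[\overset{\leftrightarrow}f\cdot J\vec a^1]_{Njk}+\delta_{i0}[\tilde f^*_{(0,L)jk}+\tfrac12\tilde g^*_{(0,L)jk}]-\delta_{iN}[\tilde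 f^*_{(N,R)jk}+\tfrac12\tilde g^*_{(N,R)jk}]\Big),$$ and $\mathcal F^2,\mathcal F^3$ defined analogously in the second index (with $\omega_{ik}$, $J\vec a^2$) and third index (with $\omega_{ij}$, $J\vec a^3$). Here $[\overset{\leftrightarrow}f\cdot J\vec a^1]$ uses the exact fluxes, $\tilde f^{1,\mathrm{vol}}_{(i,m)jk}=\overset{\leftrightarrow}f{}^{\mathrm{vol}}(u_{ijk},u_{mjk})\cdot\{\!\{J\vec a^1\}\!\}_{(i,m)jk}$, $\tilde g^{1,\mathrm{vol}}_{(i,m)jk}=\overset{\leftrightarrow}g{}^{\mathrm{vol}}(u_{ijk},u_{mjk})\cdot\{\!\{J\vec a^1\}\!\}_{(i,m)jk}$ (jump $\phi_{mjk}-\phi_{ijk}$), the starred surface quantities are defined by the same formulas with $f^*,g^*$, and $L$, $R$ denote the coincident node of the neighbouring element at the lower/upper face (jump = neighbour minus own). The mesh is conforming, neighbouring elements have aligned reference directions and the metric vectors $J\vec a^m$ normal to a shared face agree from both sides. KPEP: the discrete kinetic plus potential energy changes only by conservative interface exchange and by the work of the discretized pressure gradient, mimicking $\partial_t(\frac12\varrho\|\vec V\|^2+\varrho\phi)+\nabla\cdot\big(\vec V(\frac12\varrho\|\vec V\|^2+\varrho\phi)\big)=-\vec V\cdot\nabla p$. Precisely, let $\vec P_{ijk}\in\mathbb R^3$ be the sum over directions of the pressure contributions to the momentum equation; in direction 1 it is $\omega_{jk}\big(2\sum_mQ_{im}\{\!\{p\}\!\}\{\!\{J\vec a^1\}\!\}_{(i,m)jk}+\delta_{i0}[pJ\vec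 a^1]_{0jk}-\delta_{iN}[pJ\vec a^1]_{Njk}-\delta_{i0}\{\!\{p\}\!\}_{(0,L)}\{\!\{J\vec a^1\}\!\}+\delta_{iN}\{\!\{p\}\!\}_{(N,R)}\{\!\{J\vec a^1\}\!\}\big)$, analogously in directions 2 and 3. Then KPEP means that on every element $\frac d{dt}\sum_{ijk}J_{ijk}\omega_{ijk}\big(\frac12\varrho\|\vec V\|^2+\varrho\phi\big)_{ijk}+\sum_{ijk}\vec V_{ijk}\cdot\vec P_{ijk}$ equals minus the sum over the three directions of (upper face minus lower face) weighted sums of interface values, e.g. $-\sum_{j,k}\omega_{jk}(H_{(N,R)jk}-H_{(0,L)jk})$ in direction 1, where each interface value $H$ is a two-point function of the states and potentials on both sides and of the face metric vector, with a single value shared by the two adjacent elements. *)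

theory Defs
  imports "HOL-Analysis.Analysis" "HOL-Computational_Algebra.Polynomial"
begin

text \<open>A state is (density, momentum, last), where the last component is the total energy
  or the density-weighted potential temperature. Flux values have the same type and
  the same ordering of components. Cartesian directions, reference directions and vector
  components are all indexed by the type \<open>3\<close>.\<close>

type_synonym state = "real \<times> (real^3) \<times> real"

definition dens :: "state \<Rightarrow> real" where "dens u = fst u"
definition momt :: "state \<Rightarrow> real^3" where "momt u = fst (snd u)"
definition last_var :: "state \<Rightarrow> real" where "last_var u = snd (snd u)"

definition vel :: "state \<Rightarrow> real^3" where
  "vel u = (1 / dens u) *\<^sub>R momt u"

text \<open>\<open>Total_Energy \<gamma>\<close>: the last variable is \<open>\<rho>E = p/(\<gamma>-1) + \<rho>|V|\<^sup>2/2\<close>;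
  \<open>Potential_Temperature K \<gamma>\<close>: the last variable is \<open>\<rho>\<theta>\<close>.\<close>

datatype closure = Total_Energy real | Potential_Temperature real real

fun pressure :: "closure \<Rightarrow> state \<Rightarrow> real" where
  "pressure (Total_Energy \<gamma>) u = (\<gamma> - 1) * (last_var u - dens u * (norm (vel u))\<^sup>2 / 2)"
| "pressure (Potential_Temperature K \<gamma>) u = K * (last_var u) powr \<gamma>"

fun last_flux :: "closure \<Rightarrow> state \<Rightarrow> real^3" where
  "last_flux (Total_Energy \<gamma>) u = (last_var u + pressure (Total_Energy \<gamma>) u) *\<^sub>R vel u"
| "last_flux (Potential_Temperature K \<gamma>) u = last_var u *\<^sub>R vel u"

definition exact_flux :: "closure \<Rightarrow> 3 \<Rightarrow> state \<Rightarrow> state" where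
  "exact_flux cl d u =
     (dens u * vel u $ d,
      \<chi> c. dens u * vel u $ c * vel u $ d + (if c = d then pressure cl u else 0),
      last_flux cl u $ d)"

definition avg :: "'a::real_vector \<Rightarrow> 'a \<Rightarrow> 'a" where
  "avg a b = (1/2) *\<^sub>R (a + b)"

text \<open>A non-conservative two-point term takes, for each of the two nodes, the state and
  the value of the geopotential.\<close>

type_synonym flux2 = "3 \<Rightarrow> state \<Rightarrow> state \<Rightarrow> state"
type_synonym noncons2 = "3 \<Rightarrow> state \<Rightarrow> real \<Rightarrow> state \<Rightarrow> real \<Rightarrow> state"

record num_fluxes =
  f_vol :: flux2
  f_surf :: flux2
  g_vol :: noncons2
  g_surf :: noncons2

definition symmetric_consistent :: "closure \<Rightarrow> flux2 \<Rightarrow> bool" where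
  "symmetric_consistent cl f \<longleftrightarrow>
     (\<forall>d u u'. dens u > 0 \<longrightarrow> dens u' > 0 \<longrightarrow> f d u u' = f d u' u) \<and>
     (\<forall>d u. dens u > 0 \<longrightarrow> f d u u = exact_flux cl d u)"

definition KEP :: "closure \<Rightarrow> flux2 \<Rightarrow> bool" where
  "KEP cl f \<longleftrightarrow>
     (\<forall>d c u u'. dens u > 0 \<longrightarrow> dens u' > 0 \<longrightarrow>
        momt (f d u u') $ c =
          avg (vel u $ c) (vel u' $ c) * dens (f d u u')
          + (if c = d then avg (pressure cl u) (pressure cl u') else 0))"

definition symmetric_mean :: "(real \<Rightarrow> real \<Rightarrow> real) \<Rightarrow> bool" where
  "symmetric_mean rbar \<longleftrightarrow>
     (\<forall>a b. a > 0 \<longrightarrow> b > 0 \<longrightarrow> rbar a b = rbar b a) \<and> (\<forall>a. a > 0 \<longrightarrow> rbar a a = a)"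

definition density_flux_form :: "(real \<Rightarrow> real \<Rightarrow> real) \<Rightarrow> flux2 \<Rightarrow> bool" where
  "density_flux_form rbar f \<longleftrightarrow>
     (\<forall>d u u'. dens u > 0 \<longrightarrow> dens u' > 0 \<longrightarrow>
        dens (f d u u') = rbar (dens u) (dens u') * avg (vel u $ d) (vel u' $ d))"

text \<open>The last component of the non-conservative term (the work of gravity in the
  total energy formulation) is left unrestricted.\<close>

definition noncons_form :: "(real \<Rightarrow> real \<Rightarrow> real) \<Rightarrow> noncons2 \<Rightarrow> bool" where
  "noncons_form rbar g \<longleftrightarrow>
     (\<forall>d u \<phi> u' \<phi>'. dens u > 0 \<longrightarrow> dens u' > 0 \<longrightarrow>
        dens (g d u \<phi> u' \<phi>') = 0 \<and>
        (\<forall>c. momt (g d u \<phi> u' \<phi>') $ c =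
               (if c = d then rbar (dens u) (dens u') * (\<phi>' - \<phi>) else 0)))"

definition contract :: "(3 \<Rightarrow> state) \<Rightarrow> real^3 \<Rightarrow> state" where
  "contract f a = (\<Sum>d\<in>UNIV. (a $ d) *\<^sub>R f d)"

definition legendre :: "nat \<Rightarrow> real poly" where
  "legendre N = smult (1 / (2 ^ N * fact N)) ((pderiv ^^ N) ([:-1, 0, 1:] ^ N))"

definition LGL_nodes :: "nat \<Rightarrow> (nat \<Rightarrow> real) \<Rightarrow> bool" where
  "LGL_nodes N \<xi> \<longleftrightarrow>
     N \<ge> 1 \<and> strict_mono_on {..N} \<xi> \<and>
     \<xi> ` {..N} = {x. (1 - x\<^sup>2) * poly (pderiv (legendre N)) x = 0}"

definition lagrange :: "nat \<Rightarrow> (nat \<Rightarrow> real) \<Rightarrow> nat \<Rightarrow> real poly" where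
  "lagrange N \<xi> j = (\<Prod>m\<in>{..N} - {j}. smult (1 / (\<xi> j - \<xi> m)) [:- \<xi> m, 1:])"

definition weight :: "nat \<Rightarrow> (nat \<Rightarrow> real) \<Rightarrow> nat \<Rightarrow> real" where
  "weight N \<xi> i = integral {-1..1} (poly (lagrange N \<xi> i))"

definition Dmat :: "nat \<Rightarrow> (nat \<Rightarrow> real) \<Rightarrow> nat \<Rightarrow> nat \<Rightarrow> real" where
  "Dmat N \<xi> i j = poly (pderiv (lagrange N \<xi> j)) (\<xi> i)"

definition Qmat :: "nat \<Rightarrow> (nat \<Rightarrow> real) \<Rightarrow> nat \<Rightarrow> nat \<Rightarrow> real" where
  "Qmat N \<xi> i j = weight N \<xi> i * Dmat N \<xi> i j"

text \<open>A node (i,j,k) of an element is the function sending the three reference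
  directions to i, j, k; so \<open>n(d := m)\<close> replaces the index in direction \<open>d\<close> by \<open>m\<close>.\<close>

type_synonym node = "3 \<Rightarrow> nat"

text \<open>Elements are labelled by natural numbers. \<open>lower M d e\<close> and \<open>upper M d e\<close> are the
  neighbours of element \<open>e\<close> across its two faces in reference direction \<open>d\<close>. Such a neighbour
  need not belong to \<open>elems M\<close>: then it only carries exterior data at a boundary face.
  \<open>metric M e d n\<close> is the vector \<open>Ja\<^sup>d\<close> at node \<open>n\<close> of \<open>e\<close>.\<close>

record mesh =
  deg :: nat
  xi :: "nat \<Rightarrow> real"
  elems :: "nat set"
  lower :: "3 \<Rightarrow> nat \<Rightarrow> nat"
  upper :: "3 \<Rightarrow> nat \<Rightarrow> nat"
  jac :: "nat \<Rightarrow> node \<Rightarrow> real"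
  metric :: "nat \<Rightarrow> 3 \<Rightarrow> node \<Rightarrow> real^3"

definition nodes :: "mesh \<Rightarrow> node set" where
  "nodes M = {n. \<forall>c. n c \<le> deg M}"

definition face_nodes :: "mesh \<Rightarrow> 3 \<Rightarrow> node set" where
  "face_nodes M d = {n \<in> nodes M. n d = 0}"

definition elems_and_neighbours :: "mesh \<Rightarrow> nat set" where
  "elems_and_neighbours M = elems M \<union> (\<Union>d. lower M d ` elems M \<union> upper M d ` elems M)"

definition conforming_mesh :: "mesh \<Rightarrow> bool" where
  "conforming_mesh M \<longleftrightarrow>
     LGL_nodes (deg M) (xi M) \<and>
     (\<forall>e\<in>elems M. \<forall>n\<in>nodes M. jac M e n > 0) \<and>
     (\<forall>e\<in>elems M. \<forall>d. upper M d (lower M d e) = e \<and> lower M d (upper M d e) = e) \<and>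
     (\<forall>e\<in>elems M. \<forall>d. \<forall>n\<in>face_nodes M d.
        metric M e d n = metric M (lower M d e) d (n(d := deg M)) \<and>
        metric M e d (n(d := deg M)) = metric M (upper M d e) d n)"

definition vol_weight :: "mesh \<Rightarrow> node \<Rightarrow> real" where
  "vol_weight M n = (\<Prod>c\<in>UNIV. weight (deg M) (xi M) (n c))"

definition face_weight :: "mesh \<Rightarrow> 3 \<Rightarrow> node \<Rightarrow> real" where
  "face_weight M d n = (\<Prod>c\<in>UNIV - {d}. weight (deg M) (xi M) (n c))"

text \<open>\<open>U e n\<close> and \<open>\<phi> e n\<close> are the state and the geopotential at node \<open>n\<close> of element \<open>e\<close>.
  The coupling of two nodes is the contraction of the two-point flux with the average of
  the metric vectors \<open>Ja\<^sup>d\<close>; the first node is the own node, so the jump of \<open>\<phi>\<close> in the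
  non-conservative term is (second node) - (own node).\<close>

definition f_tilde ::
  "mesh \<Rightarrow> flux2 \<Rightarrow> (nat \<Rightarrow> node \<Rightarrow> state) \<Rightarrow> 3 \<Rightarrow> nat \<Rightarrow> node \<Rightarrow> nat \<Rightarrow> node \<Rightarrow> state" where
  "f_tilde M f U d e n e' n' =
     contract (\<lambda>c. f c (U e n) (U e' n')) (avg (metric M e d n) (metric M e' d n'))"

definition g_tilde ::
  "mesh \<Rightarrow> noncons2 \<Rightarrow> (nat \<Rightarrow> node \<Rightarrow> real) \<Rightarrow> (nat \<Rightarrow> node \<Rightarrow> state)
     \<Rightarrow> 3 \<Rightarrow> nat \<Rightarrow> node \<Rightarrow> nat \<Rightarrow> node \<Rightarrow> state" where
  "g_tilde M g \<phi> U d e n e' n' =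
     contract (\<lambda>c. g c (U e n) (\<phi> e n) (U e' n') (\<phi> e' n'))
              (avg (metric M e d n) (metric M e' d n'))"

definition rhs ::
  "closure \<Rightarrow> num_fluxes \<Rightarrow> mesh \<Rightarrow> (nat \<Rightarrow> node \<Rightarrow> real) \<Rightarrow> (nat \<Rightarrow> node \<Rightarrow> state)
     \<Rightarrow> 3 \<Rightarrow> nat \<Rightarrow> node \<Rightarrow> state" where
  "rhs cl F M \<phi> U d e n =
     (let N = deg M; Q = Qmat N (xi M); i = n d;
          fex = contract (\<lambda>c. exact_flux cl c (U e n)) (metric M e d n);
          L = lower M d e; R = upper M d e
      in face_weight M d n *\<^sub>R
        (- 2 *\<^sub>R (\<Sum>m\<le>N. Q i m *\<^sub>R f_tilde M (f_vol F) U d e n e (n(d := m)))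
         - (\<Sum>m\<le>N. Q i m *\<^sub>R g_tilde M (g_vol F) \<phi> U d e n e (n(d := m)))
         - (if i = 0 then fex else 0)
         + (if i = N then fex else 0)
         + (if i = 0 then f_tilde M (f_surf F) U d e n L (n(d := N))
              + (1/2) *\<^sub>R g_tilde M (g_surf F) \<phi> U d e n L (n(d := N)) else 0)
         - (if i = N then f_tilde M (f_surf F) U d e n R (n(d := 0))
              + (1/2) *\<^sub>R g_tilde M (g_surf F) \<phi> U d e n R (n(d := 0)) else 0)))"

definition DGSEM_solution ::
  "closure \<Rightarrow> num_fluxes \<Rightarrow> mesh \<Rightarrow> (nat \<Rightarrow> node \<Rightarrow> real) \<Rightarrow> real set
     \<Rightarrow> (real \<Rightarrow> nat \<Rightarrow> node \<Rightarrow> state) \<Rightarrow> bool" where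
  "DGSEM_solution cl F M \<phi> T u \<longleftrightarrow>
     (\<forall>t\<in>T. \<forall>e\<in>elems_and_neighbours M. \<forall>n\<in>nodes M. dens (u t e n) > 0) \<and>
     (\<forall>t\<in>T. \<forall>e\<in>elems M. \<forall>n\<in>nodes M. \<exists>u'.
        ((\<lambda>s. u s e n) has_vector_derivative u') (at t within T) \<and>
        (jac M e n * vol_weight M n) *\<^sub>R u' = (\<Sum>d\<in>UNIV. rhs cl F M \<phi> (u t) d e n))"

definition discrete_energy ::
  "mesh \<Rightarrow> (nat \<Rightarrow> node \<Rightarrow> real) \<Rightarrow> (nat \<Rightarrow> node \<Rightarrow> state) \<Rightarrow> nat \<Rightarrow> real" where
  "discrete_energy M \<phi> U e =
     (\<Sum>n\<in>nodes M. jac M e n * vol_weight M n *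
        (dens (U e n) * (norm (vel (U e n)))\<^sup>2 / 2 + dens (U e n) * \<phi> e n))"

definition pressure_dir ::
  "closure \<Rightarrow> mesh \<Rightarrow> (nat \<Rightarrow> node \<Rightarrow> state) \<Rightarrow> 3 \<Rightarrow> nat \<Rightarrow> node \<Rightarrow> real^3" where
  "pressure_dir cl M U d e n =
     (let N = deg M; Q = Qmat N (xi M); i = n d;
          p = (\<lambda>e n. pressure cl (U e n)); Ja = (\<lambda>e n. metric M e d n);
          pa = (\<lambda>e' n'. avg (p e n) (p e' n') *\<^sub>R avg (Ja e n) (Ja e' n'))
      in face_weight M d n *\<^sub>R
        (2 *\<^sub>R (\<Sum>m\<le>N. Q i m *\<^sub>R pa e (n(d := m)))
         + (if i = 0 then p e n *\<^sub>R Ja e n else 0)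
         - (if i = N then p e n *\<^sub>R Ja e n else 0)
         - (if i = 0 then pa (lower M d e) (n(d := N)) else 0)
         + (if i = N then pa (upper M d e) (n(d := 0)) else 0)))"

definition pressure_work ::
  "closure \<Rightarrow> mesh \<Rightarrow> (nat \<Rightarrow> node \<Rightarrow> state) \<Rightarrow> nat \<Rightarrow> real" where
  "pressure_work cl M U e =
     (\<Sum>n\<in>nodes M. vel (U e n) \<bullet> (\<Sum>d\<in>UNIV. pressure_dir cl M U d e n))"

text \<open>Interface function: state and potential at the own node, state and potential at the
  coincident node of the neighbour, face metric vector.\<close>

type_synonym interface_fun = "state \<Rightarrow> real \<Rightarrow> state \<Rightarrow> real \<Rightarrow> real^3 \<Rightarrow> real"

definition interface_exchange ::
  "interface_fun \<Rightarrow> mesh \<Rightarrow> (nat \<Rightarrow> node \<Rightarrow> real) \<Rightarrow> (nat \<Rightarrow> node \<Rightarrow> state)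
     \<Rightarrow> nat \<Rightarrow> real" where
  "interface_exchange H M \<phi> U e =
     (\<Sum>d\<in>UNIV. \<Sum>n\<in>face_nodes M d. face_weight M d n *
        (let n0 = n; nN = n(d := deg M); L = lower M d e; R = upper M d e
         in H (U e nN) (\<phi> e nN) (U R n0) (\<phi> R n0) (metric M e d nN)
            - H (U e n0) (\<phi> e n0) (U L nN) (\<phi> L nN) (metric M e d n0)))"

text \<open>Symmetry of \<open>H\<close> in the two nodes, together with the agreement of the metric vectors,
  says that the two elements adjacent to a face compute the same interface value. \<open>H\<close> is
  chosen before the mesh, the potential and the solution, hence depends on its arguments only.\<close>

definition KPEP :: "closure \<Rightarrow> num_fluxes \<Rightarrow> bool" where
  "KPEP cl F \<longleftrightarrow>
     (\<exists>H :: interface_fun.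
        (\<forall>u \<phi> u' \<phi>' a. dens u > 0 \<longrightarrow> dens u' > 0 \<longrightarrow> H u \<phi> u' \<phi>' a = H u' \<phi>' u \<phi> a) \<and>
        (\<forall>M \<phi> T u. conforming_mesh M \<longrightarrow> is_interval T \<longrightarrow> DGSEM_solution cl F M \<phi> T u \<longrightarrow>
           (\<forall>t\<in>T. \<forall>e\<in>elems M. \<exists>E'.
              ((\<lambda>s. discrete_energy M \<phi> (u s) e) has_real_derivative E') (at t within T) \<and>
              E' + pressure_work cl M (u t) e = - interface_exchange H M \<phi> (u t) e)))"

end

theory Submission
  imports Defs
begin

text \<open>The energy density \<open>\<rho>|V|\<^sup>2/2 + \<rho>\<phi>\<close> changes at the rate
  \<open>V \<bullet> \<partial>\<^sub>t(\<rho>V) + (\<phi> - |V|\<^sup>2/2) \<partial>\<^sub>t\<rho>\<close>, so the momentum and mass equations are paired with the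
  factors \<open>V\<close> and \<open>\<phi> - |V|\<^sup>2/2\<close>. For two nodes (the second one primed) coupled through a metric
  vector \<open>a\<close>, with \<open>f\<close> and \<open>g\<close> contracted with \<open>a\<close> and \<open>q\<close> the average pressure, the form of the momentum flux gives
  \<open>V \<bullet> f\<^sup>\<rho>\<^sup>V - |V|\<^sup>2/2 f\<^sup>\<rho> = (V \<bullet> V')/2 f\<^sup>\<rho> + q V \<bullet> a\<close>, and the common mean density gives
  \<open>\<phi> f\<^sup>\<rho> + V \<bullet> g/2 = r (\<phi> V' + \<phi>' V) \<bullet> a / 2\<close> with \<open>r\<close> the mean density. Apart from the pressure
  work, the pair therefore contributes a quantity \<open>energy_flux\<close> that is symmetric in the two
  nodes (\<open>energy_deriv_coupling\<close>). This quantity serves as the interface function.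

  A symmetric two-point quantity that is summed against \<open>2 Q\<close> along a line of nodes leaves only
  its values at the two end nodes, because \<open>Q + Q\<^sup>T = diag (-1, 0, \<dots>, 0, 1)\<close>
  (\<open>sum_Qmat_symmetric\<close>). These end values cancel the energy of the exact
  boundary fluxes, and the interface values remain (\<open>line_balance\<close>).

  The property of \<open>Q\<close> is integration by parts for the Lagrange polynomials, made
  discrete by the exactness of the Lobatto quadrature in degree \<open>2 N - 1\<close>
  (\<open>quadrature_exact\<close>). That exactness follows from the orthogonality of
  \<open>(1 - x\<^sup>2) P\<^sub>N'\<close> to the polynomials of degree at most \<open>N - 2\<close> on \<open>[-1, 1]\<close>.\<close>

section \<open>Integrals of polynomials\<close>

lemma integrable_poly: "poly p integrable_on {a..b::real}"
  by (intro integrable_continuous_interval continuous_intros)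

lemma integral_poly_0 [simp]: "integral S (poly 0) = (0::real)"
proof -
  have "poly 0 = (\<lambda>x. 0::real)" by auto
  then show ?thesis by simp
qed

lemma integral_poly_add:
  "integral {a..b::real} (poly (p + q)) = integral {a..b} (poly p) + integral {a..b} (poly q)"
proof -
  have "poly (p + q) = (\<lambda>x. poly p x + poly q x)" by auto
  then show ?thesis by (simp add: integral_add integrable_poly)
qed

lemma integral_poly_smult:
  "integral {a..b::real} (poly (smult c p)) = c * integral {a..b} (poly p)"
proof -
  have "poly (smult c p) = (\<lambda>x. c * poly p x)" by auto
  then show ?thesis by simp
qed

lemma integral_poly_sum:
  "finite I \<Longrightarrow>
     integral {a..b::real} (poly (\<Sum>i\<in>I. p i)) = (\<Sum>i\<in>I. integral {a..b} (poly (p i)))"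
  by (induction I rule: finite_induct) (simp_all add: integral_poly_add del: poly_add)

lemma integral_pderiv:
  assumes "a \<le> (b::real)"
  shows "integral {a..b} (poly (pderiv p)) = poly p b - poly p a"
proof (rule integral_unique, rule fundamental_theorem_of_calculus[OF assms])
  fix x assume "x \<in> {a..b}"
  show "(poly p has_vector_derivative poly (pderiv p) x) (at x within {a..b})"
    using poly_DERIV[of p x]
    by (simp add: has_real_derivative_iff_has_vector_derivative has_vector_derivative_at_within)
qed

lemma integral_pderiv_mult:
  assumes "a \<le> (b::real)"
  shows "integral {a..b} (poly (pderiv p * q))
    = poly (p * q) b - poly (p * q) a - integral {a..b} (poly (p * pderiv q))"
  using integral_pderiv[OF assms, of "p * q"]
  by (simp add: pderiv_mult integral_poly_add mult.commute del: poly_add poly_mult)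

section \<open>Legendre polynomials and Lobatto nodes\<close>

text \<open>The \<open>k\<close>-th derivative of \<open>(x\<^sup>2 - 1)^N\<close> keeps the zeros \<open>\<plusminus>1\<close> for \<open>k < N\<close>.\<close>

lemma power_dvd_higher_pderiv:
  "k \<le> N \<Longrightarrow> [:-1, 0, 1::real:] ^ (N - k) dvd (pderiv ^^ k) ([:-1, 0, 1:] ^ N)"
proof (induction k)
  case 0
  then show ?case by simp
next
  case (Suc k)
  then obtain s where s: "(pderiv ^^ k) ([:-1, 0, 1:] ^ N) = [:-1, 0, 1::real:] ^ (N - k) * s"
    by (auto elim: dvdE)
  obtain n where n: "N - k = Suc n" "N - Suc k = n"
    using Suc.prems by (metis Suc_diff_Suc Suc_le_lessD)
  have "[:-1, 0, 1::real:] ^ n dvd pderiv ([:-1, 0, 1:] ^ Suc n * s)"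
    unfolding pderiv_mult pderiv_power_Suc
    by (rule dvd_add[OF dvd_mult2[OF le_imp_power_dvd]
          dvd_mult[OF dvd_mult2[OF dvd_smult[OF dvd_refl]]]]) simp
  then show ?case using s n by simp
qed

text \<open>Each integration by parts moves one derivative to \<open>p\<close>, and the boundary terms vanish.\<close>

lemma higher_pderiv_orthogonal:
  assumes "k \<le> N" and "degree p < k"
  shows "integral {-1..1} (poly ((pderiv ^^ k) ([:-1, 0, 1::real:] ^ N) * p)) = 0"
  using assms
proof (induction k arbitrary: p)
  case 0
  then show ?case by simp
next
  case (Suc k)
  let ?W = "(pderiv ^^ k) ([:-1, 0, 1::real:] ^ N)"
  have "[:-1, 0, 1::real:] dvd ?W"
    using Suc.prems(1) by (intro dvd_trans[OF _ power_dvd_higher_pderiv]) (auto intro: dvd_power)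
  then have W: "poly ?W 1 = 0" "poly ?W (-1) = 0"
    by (auto elim!: dvdE)
  have "integral {-1..1} (poly (?W * pderiv p)) = 0"
  proof (cases "degree p = 0")
    case True
    then have "pderiv p = 0" by (simp add: pderiv_eq_0_iff)
    then show ?thesis by simp
  next
    case False
    then show ?thesis using Suc by (intro Suc.IH) (auto simp: degree_pderiv)
  qed
  then show ?case
    using integral_pderiv_mult[of "-1" 1 ?W p] W
    by (simp del: poly_mult add: poly_mult[of _ _ "-1"] poly_mult[of _ _ 1])
qed

lemma legendre_orthogonal:
  assumes "degree p < N"
  shows "integral {-1..1} (poly (legendre N * p)) = 0"
  using higher_pderiv_orthogonal[OF order_refl assms]
  by (simp add: legendre_def integral_poly_smult)

lemma degree_legendre_le: "degree (legendre N) \<le> N"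
proof -
  have "degree ((pderiv ^^ k) p) \<le> degree p - k" for k and p :: "real poly"
    by (induction k) (auto simp: degree_pderiv)
  from this[of N "[:-1, 0, 1:] ^ N"] show ?thesis
    using degree_power_le[of "[:-1, 0, 1::real:]" N] by (simp add: legendre_def)
qed

text \<open>The polynomial \<open>(1 - x\<^sup>2) P\<^sub>N'\<close>, whose zeros are the Lobatto nodes.\<close>

definition lobatto :: "nat \<Rightarrow> real poly" where
  "lobatto N = [:1, 0, -1:] * pderiv (legendre N)"

lemma lobatto_orthogonal:
  assumes "degree q + 2 \<le> N"
  shows "integral {-1..1} (poly (lobatto N * q)) = 0"
proof -
  let ?r = "[:1, 0, -1:] * q"
  have "degree ?r \<le> 2 + degree q"
    using degree_mult_le[of "[:1, 0, -1::real:]" q] by simp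
  then have "degree (pderiv ?r) < N"
    using assms by (auto simp: degree_pderiv)
  then have "integral {-1..1} (poly (legendre N * pderiv ?r)) = 0"
    by (rule legendre_orthogonal)
  then have "integral {-1..1} (poly (pderiv (legendre N) * ?r)) = 0"
    using integral_pderiv_mult[of "-1" 1 "legendre N" ?r]
    by (simp del: poly_mult mult_pCons_left add: poly_mult[of _ _ "-1"] poly_mult[of _ _ 1])
  moreover have "lobatto N * q = pderiv (legendre N) * ?r"
    unfolding lobatto_def by (simp only: mult_ac)
  ultimately show ?thesis by (simp only:)
qed

lemma degree_lobatto_le:
  assumes "N \<ge> 1"
  shows "degree (lobatto N) \<le> N + 1"
  using degree_mult_le[of "[:1, 0, -1::real:]" "pderiv (legendre N)"]
    degree_legendre_le[of N] assms
  by (simp add: lobatto_def degree_pderiv)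

context
  fixes N :: nat and \<xi> :: "nat \<Rightarrow> real"
  assumes LGL: "LGL_nodes N \<xi>"
begin

lemma LGL_pos: "N \<ge> 1"
  and LGL_strict_mono: "strict_mono_on {..N} \<xi>"
  and LGL_image: "\<xi> ` {..N} = {x. poly (lobatto N) x = 0}"
  using LGL by (auto simp: LGL_nodes_def lobatto_def power2_eq_square)

lemma LGL_inj: "inj_on \<xi> {..N}"
  by (rule strict_mono_on_imp_inj_on[OF LGL_strict_mono])

lemma card_LGL: "card (\<xi> ` {..N}) = N + 1"
  by (simp add: card_image[OF LGL_inj])

lemma lobatto_nonzero: "lobatto N \<noteq> 0"
proof
  assume "lobatto N = 0"
  then have "\<xi> ` {..N} = UNIV" by (simp add: LGL_image)
  then show False
    by (metis finite_atMost finite_imageI infinite_UNIV_char_0)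
qed

lemma degree_lobatto: "degree (lobatto N) = N + 1"
  using card_poly_roots_bound[OF lobatto_nonzero] LGL_image card_LGL
    degree_lobatto_le[OF LGL_pos] by simp

text \<open>A zero \<open>r\<close> of \<open>P\<^sub>N'\<close> outside \<open>[-1, 1]\<close> would contradict orthogonality: with
  \<open>P\<^sub>N' = (x - r) s\<close>, the integrand \<open>(1 - x\<^sup>2) P\<^sub>N' s = (1 - x\<^sup>2) (x - r) s\<^sup>2\<close> has constant sign.\<close>

lemma LGL_in_interval:
  assumes "poly (lobatto N) r = 0"
  shows "\<bar>r\<bar> \<le> 1"
proof (rule ccontr)
  assume "\<not> \<bar>r\<bar> \<le> 1"
  then have r: "\<bar>r\<bar> > 1" by simp
  then have "1 - r\<^sup>2 \<noteq> 0" by (auto simp: abs_square_eq_1 power2_eq_1_iff)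
  then have "poly (pderiv (legendre N)) r = 0"
    using assms by (auto simp: lobatto_def power2_eq_square)
  then obtain s where s: "pderiv (legendre N) = [:- r, 1:] * s"
    by (auto simp: poly_eq_0_iff_dvd elim: dvdE)
  have s0: "s \<noteq> 0" using lobatto_nonzero s by (auto simp: lobatto_def)
  have "degree (pderiv (legendre N)) = degree s + 1"
    unfolding s using s0 by (subst degree_mult_eq) auto
  then have "degree s + 2 \<le> N"
    using degree_legendre_le[of N] by (auto simp: degree_pderiv)
  then have int0: "integral {-1..1} (poly (lobatto N * s)) = 0"
    by (rule lobatto_orthogonal)
  \<comment> \<open>The sign that makes \<open>c (x - r)\<close> nonnegative on \<open>[-1, 1]\<close>.\<close>
  define c where "c = - sgn r"
  have prod: "c * poly (lobatto N * s) x = (1 - x\<^sup>2) * (c * (x - r)) * (poly s x)\<^sup>2" for x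
    by (simp add: lobatto_def s power2_eq_square algebra_simps)
  have nonneg: "0 \<le> c * poly (lobatto N * s) x" if "x \<in> box (-1) 1" for x
  proof -
    have "x\<^sup>2 \<le> 1" using that by (simp add: abs_square_le_1 abs_le_iff)
    moreover have "0 \<le> c * (x - r)" using that r
      by (auto simp: c_def sgn_if)
    ultimately show ?thesis unfolding prod by (intro mult_nonneg_nonneg[OF mult_nonneg_nonneg]) auto
  qed
  have "(poly (lobatto N * s) has_integral 0) (cbox (-1) 1)"
    using integrable_integral[OF integrable_poly[of "lobatto N * s" "-1" 1]]
    unfolding int0 by simp
  from has_integral_mult_right[OF this, of c]
  have "((\<lambda>x. c * poly (lobatto N * s) x) has_integral 0) (cbox (-1) 1)" by simp
  then have zero: "c * poly (lobatto N * s) x = 0" if "x \<in> {-1..1}" for x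
    using that by (intro has_integral_0_cbox_imp_0[where a = "-1" and b = 1])
      (auto intro!: continuous_intros nonneg[simplified])
  have "c \<noteq> 0" using r by (auto simp: c_def sgn_if split: if_splits)
  then have "{-1..1} \<subseteq> {x. poly (lobatto N * s) x = 0}"
    using zero by (simp only: mult_eq_0_iff simp_thms) blast
  moreover have "infinite {-1..1::real}" by (simp add: infinite_Icc_iff)
  ultimately have "lobatto N * s = 0"
    using poly_roots_finite[of "lobatto N * s"] finite_subset by blast
  then show False using s0 lobatto_nonzero by simp
qed

lemma LGL_endpoints: "\<xi> 0 = -1" "\<xi> N = 1"
proof -
  have "-1 \<in> \<xi> ` {..N}" "1 \<in> \<xi> ` {..N}"
    unfolding LGL_image by (auto simp: lobatto_def)
  then obtain i j where i: "i \<le> N" "\<xi> i = -1" and j: "j \<le> N" "\<xi> j = 1" by auto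
  have mono: "\<xi> a \<le> \<xi> b" if "a \<le> b" "b \<le> N" for a b
    using strict_mono_on_leD[OF LGL_strict_mono, of a b] that by simp
  have bound: "\<bar>\<xi> a\<bar> \<le> 1" if "a \<le> N" for a
    using that LGL_image by (intro LGL_in_interval) auto
  show "\<xi> 0 = -1" using mono[of 0 i] i bound[of 0] by auto
  show "\<xi> N = 1" using mono[of j N] j bound[of N] by auto
qed

section \<open>Lobatto quadrature and summation by parts\<close>

lemma poly_lagrange:
  assumes "i \<le> N" "j \<le> N"
  shows "poly (lagrange N \<xi> j) (\<xi> i) = (if i = j then 1 else 0)"
proof (cases "i = j")
  case True
  have "poly (smult (1 / (\<xi> j - \<xi> m)) [:- \<xi> m, 1:]) (\<xi> j) = 1" if "m \<in> {..N} - {j}" for m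
  proof -
    have "\<xi> j \<noteq> \<xi> m" using LGL_inj that assms by (auto simp: inj_on_def)
    then show ?thesis by (simp add: divide_simps)
  qed
  then show ?thesis unfolding lagrange_def poly_prod using True by simp
next
  case False
  then show ?thesis using assms by (auto simp: lagrange_def poly_prod intro!: prod_zero)
qed

lemma degree_lagrange:
  assumes "j \<le> N"
  shows "degree (lagrange N \<xi> j) \<le> N"
proof -
  have "degree (lagrange N \<xi> j)
      \<le> (\<Sum>m\<in>{..N} - {j}. degree (smult (1 / (\<xi> j - \<xi> m)) [:- \<xi> m, 1:]))"
    unfolding lagrange_def
    by (rule order_trans[OF degree_prod_sum_le]) (auto simp: o_def)
  also have "\<dots> \<le> (\<Sum>m\<in>{..N} - {j}. 1)"
    by (intro sum_mono) (auto intro: order_trans[OF degree_smult_le])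
  also have "\<dots> = N" using assms by simp
  finally show ?thesis .
qed

lemma lagrange_interpolation:
  assumes "degree r \<le> N"
  shows "r = (\<Sum>i\<le>N. smult (poly r (\<xi> i)) (lagrange N \<xi> i))"
proof (rule poly_eqI_degree[where A = "\<xi> ` {..N}"])
  fix x assume "x \<in> \<xi> ` {..N}"
  then obtain k where k: "k \<le> N" "x = \<xi> k" by auto
  then show "poly r x = poly (\<Sum>i\<le>N. smult (poly r (\<xi> i)) (lagrange N \<xi> i)) x"
    by (simp add: poly_sum poly_lagrange if_distrib[of "(*) _"] sum.delta cong: if_cong)
next
  have "degree (\<Sum>i\<le>N. smult (poly r (\<xi> i)) (lagrange N \<xi> i)) \<le> N"
    by (intro degree_sum_le) (auto intro: order_trans[OF degree_smult_le] degree_lagrange)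
  then show "degree (\<Sum>i\<le>N. smult (poly r (\<xi> i)) (lagrange N \<xi> i)) < card (\<xi> ` {..N})"
    using card_LGL by simp
qed (use assms card_LGL in simp)

text \<open>Division by \<open>lobatto N\<close> leaves a remainder of degree at most \<open>N\<close>, which has the same nodal
  values and is integrated exactly by interpolation; the quotient part integrates to \<open>0\<close> by
  orthogonality.\<close>

lemma quadrature_exact:
  assumes "degree p + 1 \<le> 2 * N"
  shows "integral {-1..1} (poly p) = (\<Sum>i\<le>N. weight N \<xi> i * poly p (\<xi> i))"
proof -
  define q where "q = p div lobatto N"
  define r where "r = p mod lobatto N"
  have p: "p = lobatto N * q + r" by (simp add: q_def r_def)
  have deg_r: "degree r \<le> N"
    using degree_mod_less[OF lobatto_nonzero, of p] degree_lobatto by (auto simp: r_def)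
  have "integral {-1..1} (poly (lobatto N * q)) = 0"
  proof (cases "q = 0")
    case False
    then have "degree (lobatto N * q) = N + 1 + degree q"
      using lobatto_nonzero by (simp add: degree_mult_eq degree_lobatto)
    moreover have "lobatto N * q = p - r" using p by simp
    then have "degree (lobatto N * q) \<le> max (degree p) (degree r)"
      by (metis degree_diff_le_max)
    ultimately have "degree q + 2 \<le> N" using assms deg_r by (auto simp: max_def split: if_splits)
    then show ?thesis by (rule lobatto_orthogonal)
  qed auto
  then have "integral {-1..1} (poly p) = integral {-1..1} (poly r)"
    by (subst p) (simp only: integral_poly_add)
  also have "\<dots> = (\<Sum>i\<le>N. weight N \<xi> i * poly r (\<xi> i))"
    by (subst lagrange_interpolation[OF deg_r])
      (simp only: integral_poly_sum finite_atMost integral_poly_smult weight_def mult.commute)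
  also have "\<dots> = (\<Sum>i\<le>N. weight N \<xi> i * poly p (\<xi> i))"
  proof (rule sum.cong)
    fix i assume "i \<in> {..N}"
    then have "poly (lobatto N) (\<xi> i) = 0" using LGL_image by auto
    then show "weight N \<xi> i * poly r (\<xi> i) = weight N \<xi> i * poly p (\<xi> i)"
      by (subst p) simp
  qed simp
  finally show ?thesis .
qed

text \<open>The quadrature is exact for \<open>l\<^sub>i l\<^sub>j'\<close>, so \<open>Q\<close> is the matrix of the bilinear form
  \<open>\<integral> l\<^sub>i l\<^sub>j'\<close>, and the identity is integration by parts.\<close>

lemma Qmat_integral:
  assumes "i \<le> N" "j \<le> N"
  shows "Qmat N \<xi> i j = integral {-1..1} (poly (lagrange N \<xi> i * pderiv (lagrange N \<xi> j)))"
proof -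
  let ?p = "lagrange N \<xi> i * pderiv (lagrange N \<xi> j)"
  have "degree ?p \<le> degree (lagrange N \<xi> i) + (degree (lagrange N \<xi> j) - 1)"
    using degree_mult_le[of "lagrange N \<xi> i" "pderiv (lagrange N \<xi> j)"] by (simp add: degree_pderiv)
  then have "degree ?p + 1 \<le> 2 * N"
    using degree_lagrange[OF assms(1)] degree_lagrange[OF assms(2)] LGL_pos by linarith
  then have "integral {-1..1} (poly ?p) = (\<Sum>k\<le>N. weight N \<xi> k * poly ?p (\<xi> k))"
    by (rule quadrature_exact)
  also have "\<dots> = (\<Sum>k\<le>N. if k = i then weight N \<xi> k * Dmat N \<xi> k j else 0)"
    using assms by (intro sum.cong) (auto simp: poly_lagrange Dmat_def)
  also have "\<dots> = Qmat N \<xi> i j" using assms by (simp add: Qmat_def)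
  finally show ?thesis by simp
qed

lemma summation_by_parts:
  assumes "i \<le> N" "j \<le> N"
  shows "Qmat N \<xi> i j + Qmat N \<xi> j i =
    (if i = N \<and> j = N then 1 else 0) - (if i = 0 \<and> j = 0 then 1 else 0)"
proof -
  have "Qmat N \<xi> i j + Qmat N \<xi> j i
      = poly (lagrange N \<xi> j * lagrange N \<xi> i) 1 - poly (lagrange N \<xi> j * lagrange N \<xi> i) (-1)"
    using integral_pderiv_mult[of "-1" 1 "lagrange N \<xi> j" "lagrange N \<xi> i"] assms
    by (simp add: Qmat_integral mult.commute)
  also have "\<dots> = poly (lagrange N \<xi> j * lagrange N \<xi> i) (\<xi> N)
      - poly (lagrange N \<xi> j * lagrange N \<xi> i) (\<xi> 0)"
    by (simp only: LGL_endpoints)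
  also have "\<dots> = (if i = N \<and> j = N then 1 else 0) - (if i = 0 \<and> j = 0 then 1 else 0)"
    using assms by (auto simp: poly_lagrange)
  finally show ?thesis .
qed

text \<open>Only the symmetric part of \<open>Q\<close> acts on a symmetric two-point quantity.\<close>

lemma sum_Qmat_symmetric:
  assumes sym: "\<And>i m. i \<le> N \<Longrightarrow> m \<le> N \<Longrightarrow> S i m = S m i"
  shows "2 * (\<Sum>i\<le>N. \<Sum>m\<le>N. Qmat N \<xi> i m * S i m) = S N N - S 0 0"
proof -
  let ?Q = "Qmat N \<xi>"
  have "(\<Sum>i\<le>N. \<Sum>m\<le>N. ?Q i m * S i m) = (\<Sum>i\<le>N. \<Sum>m\<le>N. ?Q m i * S m i)"
    by (rule sum.swap)
  also have "\<dots> = (\<Sum>i\<le>N. \<Sum>m\<le>N. ?Q m i * S i m)"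
    using sym by (intro sum.cong) auto
  finally have "2 * (\<Sum>i\<le>N. \<Sum>m\<le>N. ?Q i m * S i m)
      = (\<Sum>i\<le>N. \<Sum>m\<le>N. (?Q i m + ?Q m i) * S i m)"
    by (simp add: sum.distrib distrib_right)
  also have "\<dots> = (\<Sum>i\<le>N. \<Sum>m\<le>N. (if m = N then if i = N then S N N else 0 else 0)
      - (if m = 0 then if i = 0 then S 0 0 else 0 else 0))"
    by (intro sum.cong) (auto simp: summation_by_parts)
  also have "\<dots> = S N N - S 0 0"
    by (simp add: sum_subtractf sum.delta)
  finally show ?thesis .
qed

end

section \<open>The energy balance of one coupling\<close>

lemma dens_linear [simp]:
  "dens (x + y) = dens x + dens y" "dens (x - y) = dens x - dens y"
  "dens (r *\<^sub>R x) = r * dens x" "dens 0 = 0"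
  by (simp_all add: dens_def)

lemma momt_linear [simp]:
  "momt (x + y) = momt x + momt y" "momt (x - y) = momt x - momt y"
  "momt (r *\<^sub>R x) = r *\<^sub>R momt x" "momt 0 = 0"
  by (simp_all add: momt_def)

lemma dens_sum: "dens (\<Sum>i\<in>I. f i) = (\<Sum>i\<in>I. dens (f i))"
  by (simp add: dens_def fst_sum)

lemma momt_sum: "momt (\<Sum>i\<in>I. f i) = (\<Sum>i\<in>I. momt (f i))"
  by (simp add: momt_def fst_sum snd_sum)

text \<open>The derivative of \<open>\<rho>|V|\<^sup>2/2 + \<rho>\<phi>\<close> with respect to the conserved variables at \<open>u\<close>,
  applied to the direction \<open>x\<close>.\<close>

definition energy_deriv :: "state \<Rightarrow> real \<Rightarrow> state \<Rightarrow> real" where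
  "energy_deriv u \<phi> x = vel u \<bullet> momt x + (\<phi> - (norm (vel u))\<^sup>2 / 2) * dens x"

lemma energy_deriv_linear:
  "energy_deriv u \<phi> (x + y) = energy_deriv u \<phi> x + energy_deriv u \<phi> y"
  "energy_deriv u \<phi> (x - y) = energy_deriv u \<phi> x - energy_deriv u \<phi> y"
  "energy_deriv u \<phi> (r *\<^sub>R x) = r * energy_deriv u \<phi> x"
  "energy_deriv u \<phi> 0 = 0"
  by (simp_all add: energy_deriv_def inner_simps distrib_left right_diff_distrib mult.left_commute)

lemma energy_deriv_sum:
  "energy_deriv u \<phi> (\<Sum>i\<in>I. f i) = (\<Sum>i\<in>I. energy_deriv u \<phi> (f i))"
  by (simp add: energy_deriv_def dens_sum momt_sum inner_sum_right sum_distrib_left sum.distrib)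

text \<open>The energy that two nodes exchange through a metric vector \<open>a\<close>, a symmetric function
  of the two nodes and a two-point version of \<open>(\<rho>|V|\<^sup>2/2 + \<rho>\<phi>) V \<bullet> a\<close>.\<close>

definition energy_flux :: "(real \<Rightarrow> real \<Rightarrow> real) \<Rightarrow> interface_fun" where
  "energy_flux rbar u \<phi> u' \<phi>' a =
     rbar (dens u) (dens u') *
       ((vel u \<bullet> vel u') * (avg (vel u) (vel u') \<bullet> a) + (\<phi> *\<^sub>R vel u' + \<phi>' *\<^sub>R vel u) \<bullet> a) / 2"

lemma energy_flux_commute:
  assumes "symmetric_mean rbar" "dens u > 0" "dens u' > 0"
  shows "energy_flux rbar u \<phi> u' \<phi>' a = energy_flux rbar u' \<phi>' u \<phi> a"
  using assms
  by (simp add: energy_flux_def symmetric_mean_def avg_def inner_commute add.commute)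

lemma avg_same [simp]: "avg a a = a"
  by (simp add: avg_def scaleR_2[symmetric])

lemma avg_commute: "avg a b = avg b a"
  by (simp add: avg_def add.commute)

lemma sum_scaleR_axis: "(\<Sum>d\<in>UNIV. (a $ d) *\<^sub>R axis d 1) = (a :: real^'n)"
  by (simp add: vec_eq_iff axis_def if_distrib[of "(*) _"] sum.delta cong: if_cong)

text \<open>A flux whose momentum part is transport of a velocity \<open>v\<close> plus a pressure \<open>p\<close> keeps
  this form after contraction with a metric vector.\<close>

lemma contract_transport:
  assumes "\<And>d c. momt (f d) $ c = v $ c * dens (f d) + (if c = d then p else 0)"
  shows "momt (contract f a) = dens (contract f a) *\<^sub>R v + p *\<^sub>R a"
proof -
  have "momt (f d) = dens (f d) *\<^sub>R v + p *\<^sub>R axis d 1" for d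
    using assms by (simp add: vec_eq_iff axis_def)
  then have "momt (contract f a) = (\<Sum>d\<in>UNIV. (a $ d * dens (f d)) *\<^sub>R v)
      + p *\<^sub>R (\<Sum>d\<in>UNIV. (a $ d) *\<^sub>R axis d 1)"
    by (simp add: contract_def momt_sum scaleR_add_right sum.distrib scaleR_sum_right mult.commute)
  then show ?thesis
    by (simp add: contract_def dens_sum scaleR_sum_left sum_scaleR_axis)
qed

lemma dens_contract:
  assumes "\<And>d. dens (f d) = r * v $ d"
  shows "dens (contract f a) = r * (v \<bullet> a)"
  using assms by (simp add: contract_def dens_sum inner_vec_def sum_distrib_left mult_ac)

lemma inner_avg_half_square:
  "v \<bullet> avg v w - (norm v)\<^sup>2 / 2 = (v \<bullet> w) / (2::real)"
  by (simp add: avg_def inner_add_right power2_norm_eq_inner add_divide_distrib)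

text \<open>The density transport that the potential energy sees, \<open>\<phi> f\<^sup>\<rho>\<close>, and the work
  \<open>V \<bullet> g/2\<close> of gravity are not symmetric separately. With a common mean density the terms
  \<open>\<phi> V \<bullet> a\<close> cancel and the sum is symmetric in the two nodes.\<close>

lemma energy_deriv_coupling:
  assumes f: "KEP cl f" "density_flux_form rbar f" and g: "noncons_form rbar g"
    and pos: "dens u > 0" "dens u' > 0"
  shows "energy_deriv u \<phi> (contract (\<lambda>c. f c u u') a)
      + energy_deriv u \<phi> (contract (\<lambda>c. g c u \<phi> u' \<phi>') a) / 2
    = energy_flux rbar u \<phi> u' \<phi>' a + avg (pressure cl u) (pressure cl u') * (vel u \<bullet> a)"
proof -
  let ?V = "vel u" and ?V' = "vel u'" and ?r = "rbar (dens u) (dens u')"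
  let ?p = "avg (pressure cl u) (pressure cl u')"
  have avg_nth: "avg (?V $ c) (?V' $ c) = avg ?V ?V' $ c" for c
    by (simp add: avg_def)
  have f\<rho>: "dens (contract (\<lambda>c. f c u u') a) = ?r * (avg ?V ?V' \<bullet> a)"
    using f(2)[unfolded density_flux_form_def, rule_format, OF pos]
    by (intro dens_contract) (simp add: avg_nth)
  have fm: "momt (contract (\<lambda>c. f c u u') a) = (?r * (avg ?V ?V' \<bullet> a)) *\<^sub>R avg ?V ?V' + ?p *\<^sub>R a"
    using f(1)[unfolded KEP_def, rule_format, OF pos] unfolding f\<rho>[symmetric]
    by (intro contract_transport) (simp only: avg_nth)
  note g' = g[unfolded noncons_form_def, rule_format, OF pos]
  have g\<rho>: "dens (contract (\<lambda>c. g c u \<phi> u' \<phi>') a) = 0"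
    using g' dens_contract[of "\<lambda>c. g c u \<phi> u' \<phi>'" 0 0 a] by simp
  have gm: "momt (contract (\<lambda>c. g c u \<phi> u' \<phi>') a) = (?r * (\<phi>' - \<phi>)) *\<^sub>R a"
    using g' contract_transport[of "\<lambda>c. g c u \<phi> u' \<phi>'" 0 "?r * (\<phi>' - \<phi>)" a]
    by simp
  have "energy_deriv u \<phi> (contract (\<lambda>c. f c u u') a)
      = ?r * (avg ?V ?V' \<bullet> a) * ((?V \<bullet> avg ?V ?V' - (norm ?V)\<^sup>2 / 2) + \<phi>) + ?p * (?V \<bullet> a)"
    unfolding energy_deriv_def f\<rho> fm by (simp add: inner_simps algebra_simps)
  also have "\<dots> = ?r * (avg ?V ?V' \<bullet> a) * ((?V \<bullet> ?V') / 2 + \<phi>) + ?p * (?V \<bullet> a)"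
    unfolding inner_avg_half_square ..
  finally show ?thesis
    unfolding energy_deriv_def[of u \<phi> "contract (\<lambda>c. g c u \<phi> u' \<phi>') a"] g\<rho> gm energy_flux_def
    by (simp add: avg_def inner_simps field_simps)
qed

lemma energy_deriv_exact_flux:
  assumes rbar: "symmetric_mean rbar" and pos: "dens u > 0"
  shows "energy_deriv u \<phi> (contract (\<lambda>c. exact_flux cl c u) a)
    = energy_flux rbar u \<phi> u \<phi> a + pressure cl u * (vel u \<bullet> a)"
proof -
  let ?f = "\<lambda>c. exact_flux cl c u"
  have \<rho>: "dens (contract ?f a) = dens u * (vel u \<bullet> a)"
    by (intro dens_contract) (simp add: exact_flux_def dens_def)
  have m: "momt (contract ?f a) = (dens u * (vel u \<bullet> a)) *\<^sub>R vel u + pressure cl u *\<^sub>R a"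
    unfolding \<rho>[symmetric]
    by (intro contract_transport) (simp add: exact_flux_def momt_def dens_def)
  have mean: "rbar (dens u) (dens u) = dens u" using rbar pos by (simp add: symmetric_mean_def)
  have potential: "(\<phi> *\<^sub>R vel u + \<phi> *\<^sub>R vel u) \<bullet> a = 2 * \<phi> * (vel u \<bullet> a)"
    by (simp only: inner_add_left inner_scaleR_left)
  show ?thesis
    unfolding energy_deriv_def \<rho> m energy_flux_def avg_same mean potential
    by (simp add: inner_add_right power2_norm_eq_inner algebra_simps)
qed

section \<open>The energy balance of one element\<close>

text \<open>The energy exchange between node \<open>n\<close> of element \<open>e\<close> and node \<open>n'\<close> of element \<open>e'\<close>
  in reference direction \<open>d\<close>.\<close>

definition node_exchange ::
  "(real \<Rightarrow> real \<Rightarrow> real) \<Rightarrow> mesh \<Rightarrow> (nat \<Rightarrow> node \<Rightarrow> real) \<Rightarrow> (nat \<Rightarrow> node \<Rightarrow> state)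
     \<Rightarrow> 3 \<Rightarrow> nat \<Rightarrow> node \<Rightarrow> nat \<Rightarrow> node \<Rightarrow> real" where
  "node_exchange rbar M \<phi> U d e n e' n' =
     energy_flux rbar (U e n) (\<phi> e n) (U e' n') (\<phi> e' n') (avg (metric M e d n) (metric M e' d n'))"

text \<open>The bracket of the scheme in direction \<open>d\<close> with \<open>node_exchange\<close> as the only two-point
  quantity.\<close>

definition energy_bracket ::
  "(real \<Rightarrow> real \<Rightarrow> real) \<Rightarrow> mesh \<Rightarrow> (nat \<Rightarrow> node \<Rightarrow> real) \<Rightarrow> (nat \<Rightarrow> node \<Rightarrow> state)
     \<Rightarrow> 3 \<Rightarrow> nat \<Rightarrow> node \<Rightarrow> real" where
  "energy_bracket rbar M \<phi> U d e n =
     (let N = deg M; X = node_exchange rbar M \<phi> U d e n in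
        - 2 * (\<Sum>m\<le>N. Qmat N (xi M) (n d) m * X e (n(d := m)))
        - (if n d = 0 then X e n else 0)
        + (if n d = N then X e n else 0)
        + (if n d = 0 then X (lower M d e) (n(d := N)) else 0)
        - (if n d = N then X (upper M d e) (n(d := 0)) else 0))"

text \<open>The pressure parts of all couplings of a node in direction \<open>d\<close> are the negative of the work
  \<open>V \<bullet> P\<close> of the discretized pressure gradient, so only the exchange quantities remain.\<close>

lemma node_balance:
  assumes rbar: "symmetric_mean rbar"
    and vol: "KEP cl (f_vol F)" "density_flux_form rbar (f_vol F)" "noncons_form rbar (g_vol F)"
    and surf: "KEP cl (f_surf F)" "density_flux_form rbar (f_surf F)" "noncons_form rbar (g_surf F)"
    and pos: "dens (U e n) > 0" "\<And>m. m \<le> deg M \<Longrightarrow> dens (U e (n(d := m))) > 0"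
      "dens (U (lower M d e) (n(d := deg M))) > 0" "dens (U (upper M d e) (n(d := 0))) > 0"
  shows "energy_deriv (U e n) (\<phi> e n) (rhs cl F M \<phi> U d e n)
      + vel (U e n) \<bullet> pressure_dir cl M U d e n
    = face_weight M d n * energy_bracket rbar M \<phi> U d e n"
proof -
  let ?N = "deg M" and ?V = "vel (U e n)" and ?L = "lower M d e" and ?R = "upper M d e"
  let ?Q = "Qmat ?N (xi M) (n d)"
  let ?X = "node_exchange rbar M \<phi> U d e n"
  define \<epsilon> where "\<epsilon> = energy_deriv (U e n) (\<phi> e n)"
  define P where "P e' n' = avg (pressure cl (U e n)) (pressure cl (U e' n'))
    * (?V \<bullet> avg (metric M e d n) (metric M e' d n'))" for e' n'
  note \<epsilon>_linear = energy_deriv_linear[of "U e n" "\<phi> e n", folded \<epsilon>_def]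
  have couple: "\<epsilon> (f_tilde M f U d e n e' n') + \<epsilon> (g_tilde M g \<phi> U d e n e' n') / 2 = ?X e' n' + P e' n'"
    if "KEP cl f" "density_flux_form rbar f" "noncons_form rbar g" "dens (U e' n') > 0" for f g e' n'
    unfolding f_tilde_def g_tilde_def \<epsilon>_def P_def node_exchange_def
    by (rule energy_deriv_coupling[OF that(1-3) pos(1) that(4)])
  have "\<epsilon> (\<Sum>m\<le>?N. ?Q m *\<^sub>R f_tilde M (f_vol F) U d e n e (n(d := m)))
      + \<epsilon> (\<Sum>m\<le>?N. ?Q m *\<^sub>R g_tilde M (g_vol F) \<phi> U d e n e (n(d := m))) / 2
    = (\<Sum>m\<le>?N. ?Q m * (\<epsilon> (f_tilde M (f_vol F) U d e n e (n(d := m)))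
        + \<epsilon> (g_tilde M (g_vol F) \<phi> U d e n e (n(d := m))) / 2))"
    by (simp add: energy_deriv_sum \<epsilon>_def energy_deriv_linear distrib_left sum.distrib
        sum_divide_distrib)
  also have "\<dots> = (\<Sum>m\<le>?N. ?Q m * ?X e (n(d := m))) + (\<Sum>m\<le>?N. ?Q m * P e (n(d := m)))"
    unfolding sum.distrib[symmetric] distrib_left[symmetric]
    by (intro sum.cong refl arg_cong2[where f = "(*)"] couple[OF vol] pos(2)) simp
  finally have volume: "\<epsilon> (\<Sum>m\<le>?N. ?Q m *\<^sub>R f_tilde M (f_vol F) U d e n e (n(d := m)))
      + \<epsilon> (\<Sum>m\<le>?N. ?Q m *\<^sub>R g_tilde M (g_vol F) \<phi> U d e n e (n(d := m))) / 2
    = (\<Sum>m\<le>?N. ?Q m * ?X e (n(d := m))) + (\<Sum>m\<le>?N. ?Q m * P e (n(d := m)))" .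
  have exact: "\<epsilon> (contract (\<lambda>c. exact_flux cl c (U e n)) (metric M e d n)) = ?X e n + P e n"
    unfolding \<epsilon>_def P_def node_exchange_def avg_same
    by (rule energy_deriv_exact_flux[OF rbar pos(1)])
  note lower = couple[OF surf pos(3)] and upper = couple[OF surf pos(4)]
  have pressure: "?V \<bullet> pressure_dir cl M U d e n = face_weight M d n *
      (2 * (\<Sum>m\<le>?N. ?Q m * P e (n(d := m)))
       + (if n d = 0 then P e n else 0) - (if n d = ?N then P e n else 0)
       - (if n d = 0 then P ?L (n(d := ?N)) else 0) + (if n d = ?N then P ?R (n(d := 0)) else 0))"
    unfolding pressure_dir_def Let_def P_def avg_same
    by (simp add: inner_add_right inner_diff_right inner_sum_right if_distrib[of "\<lambda>x. ?V \<bullet> x"]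
        mult.assoc
        cong: if_cong)
  have eps_if: "\<epsilon> (if b then x else 0) = (if b then \<epsilon> x else 0)" for b x
    by (simp add: \<epsilon>_linear)
  show ?thesis
    unfolding pressure rhs_def energy_bracket_def Let_def \<epsilon>_def[symmetric] \<epsilon>_linear eps_if
      distrib_left[symmetric]
    using volume exact lower upper
    by (intro arg_cong2[where f = "(*)"] refl; cases "n d = 0"; cases "n d = ?N";
        simp only: if_True if_False simp_thms; linarith)
qed

text \<open>Summed over the line of nodes through \<open>n\<close> in direction \<open>d\<close>, the volume terms reduce to
  the exchange of the two end nodes with themselves. This cancels the exact
  boundary flux terms, which are the same quantities.\<close>

lemma line_balance:
  assumes rbar: "symmetric_mean rbar" and LGL: "LGL_nodes (deg M) (xi M)"
    and n: "n d = 0" and pos: "\<And>m. m \<le> deg M \<Longrightarrow> dens (U e (n(d := m))) > 0"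
  shows "(\<Sum>i\<le>deg M. energy_bracket rbar M \<phi> U d e (n(d := i)))
    = node_exchange rbar M \<phi> U d e n (lower M d e) (n(d := deg M))
      - node_exchange rbar M \<phi> U d e (n(d := deg M)) (upper M d e) n"
proof -
  let ?N = "deg M"
  define S where "S i m = node_exchange rbar M \<phi> U d e (n(d := i)) e (n(d := m))" for i m
  have n0: "n(d := 0) = n" using n by auto
  have "S i m = S m i" if "i \<le> ?N" "m \<le> ?N" for i m
    unfolding S_def node_exchange_def avg_commute[of "metric M e d (n(d := i))"]
    by (rule energy_flux_commute[OF rbar]) (simp_all add: pos that)
  then have "2 * (\<Sum>i\<le>?N. \<Sum>m\<le>?N. Qmat ?N (xi M) i m * S i m) = S ?N ?N - S 0 0"
    by (rule sum_Qmat_symmetric[OF LGL])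
  then show ?thesis
    unfolding energy_bracket_def Let_def S_def
    by (simp add: sum.distrib sum_subtractf sum_negf sum_distrib_left[symmetric] n0)
qed

lemma sum_nodes_lines:
  "(\<Sum>n\<in>nodes M. g n) = (\<Sum>n\<in>face_nodes M d. \<Sum>i\<le>deg M. g (n(d := i)))"
proof -
  have "(\<Sum>n\<in>nodes M. g n) = (\<Sum>(n, i)\<in>face_nodes M d \<times> {..deg M}. g (n(d := i)))"
    by (rule sum.reindex_bij_witness[where i = "\<lambda>(n, i). n(d := i)" and j = "\<lambda>n. (n(d := 0), n d)"])
      (auto simp: face_nodes_def nodes_def)
  then show ?thesis by (simp add: sum.cartesian_product)
qed

lemma face_weight_upd: "face_weight M d (n(d := i)) = face_weight M d n"
  unfolding face_weight_def by (rule prod.cong) auto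

lemma element_balance:
  assumes rbar: "symmetric_mean rbar"
    and vol: "KEP cl (f_vol F)" "density_flux_form rbar (f_vol F)" "noncons_form rbar (g_vol F)"
    and surf: "KEP cl (f_surf F)" "density_flux_form rbar (f_surf F)" "noncons_form rbar (g_surf F)"
    and mesh: "conforming_mesh M" and e: "e \<in> elems M"
    and pos: "\<And>e n. e \<in> elems_and_neighbours M \<Longrightarrow> n \<in> nodes M \<Longrightarrow> dens (U e n) > 0"
  shows "(\<Sum>n\<in>nodes M. \<Sum>d\<in>UNIV. energy_deriv (U e n) (\<phi> e n) (rhs cl F M \<phi> U d e n))
      + pressure_work cl M U e
    = - interface_exchange (energy_flux rbar) M \<phi> U e"
proof -
  let ?N = "deg M"
  let ?X = "node_exchange rbar M \<phi> U"
  have LGL: "LGL_nodes ?N (xi M)" using mesh by (simp add: conforming_mesh_def)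
  have nbr: "e \<in> elems_and_neighbours M" "lower M d e \<in> elems_and_neighbours M"
    "upper M d e \<in> elems_and_neighbours M" for d
    using e by (auto simp: elems_and_neighbours_def)
  have upd: "n(d := m) \<in> nodes M" if "n \<in> nodes M" "m \<le> ?N" for n d m
    using that by (auto simp: nodes_def)
  have node: "energy_deriv (U e n) (\<phi> e n) (rhs cl F M \<phi> U d e n)
      + vel (U e n) \<bullet> pressure_dir cl M U d e n
    = face_weight M d n * energy_bracket rbar M \<phi> U d e n" if "n \<in> nodes M" for n d
    by (rule node_balance[OF rbar vol surf]) (auto intro!: pos nbr upd that)
  have "(\<Sum>n\<in>nodes M. \<Sum>d\<in>UNIV. energy_deriv (U e n) (\<phi> e n) (rhs cl F M \<phi> U d e n))
      + pressure_work cl M U e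
    = (\<Sum>n\<in>nodes M. \<Sum>d\<in>UNIV. face_weight M d n * energy_bracket rbar M \<phi> U d e n)"
    unfolding pressure_work_def inner_sum_right sum.distrib[symmetric]
    by (intro sum.cong refl node)
  also have "\<dots> = (\<Sum>d\<in>UNIV. \<Sum>n\<in>nodes M. face_weight M d n * energy_bracket rbar M \<phi> U d e n)"
    by (rule sum.swap)
  also have "\<dots> = (\<Sum>d\<in>UNIV. \<Sum>n\<in>face_nodes M d. face_weight M d n *
      (\<Sum>i\<le>?N. energy_bracket rbar M \<phi> U d e (n(d := i))))"
  proof (rule sum.cong[OF refl])
    fix d :: 3
    show "(\<Sum>n\<in>nodes M. face_weight M d n * energy_bracket rbar M \<phi> U d e n)
        = (\<Sum>n\<in>face_nodes M d. face_weight M d n *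
            (\<Sum>i\<le>?N. energy_bracket rbar M \<phi> U d e (n(d := i))))"
      by (simp add: sum_nodes_lines[of _ M d] face_weight_upd sum_distrib_left)
  qed
  also have "\<dots> = (\<Sum>d\<in>UNIV. \<Sum>n\<in>face_nodes M d. face_weight M d n *
      (?X d e n (lower M d e) (n(d := ?N)) - ?X d e (n(d := ?N)) (upper M d e) n))"
  proof (intro sum.cong refl arg_cong2[where f = "(*)"])
    fix d n assume "n \<in> face_nodes M d"
    then have "n d = 0" "n \<in> nodes M" by (auto simp: face_nodes_def)
    then show "(\<Sum>i\<le>?N. energy_bracket rbar M \<phi> U d e (n(d := i)))
        = ?X d e n (lower M d e) (n(d := ?N)) - ?X d e (n(d := ?N)) (upper M d e) n"
      using pos[OF nbr(1) upd] by (intro line_balance[OF rbar LGL]) auto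
  qed
  also have "\<dots> = - interface_exchange (energy_flux rbar) M \<phi> U e"
  proof -
    have metric: "metric M (lower M d e) d (n(d := ?N)) = metric M e d n"
      "metric M (upper M d e) d n = metric M e d (n(d := ?N))" if "n \<in> face_nodes M d" for d n
      using mesh e that by (auto simp: conforming_mesh_def)
    show ?thesis
      unfolding interface_exchange_def Let_def sum_negf[symmetric] node_exchange_def
      by (intro sum.cong refl) (simp add: metric algebra_simps)
  qed
  finally show ?thesis .
qed

section \<open>The time derivative of the discrete energy\<close>

text \<open>In terms of the conserved variables the kinetic energy is \<open>|m|\<^sup>2 / (2 \<rho>)\<close>; at \<open>\<rho> = 0\<close>
  both sides are \<open>0\<close>.\<close>

lemma kinetic_energy_momentum:
  "dens u * (norm (vel u))\<^sup>2 / 2 = (momt u \<bullet> momt u) / (2 * dens u)"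
  unfolding vel_def power2_norm_eq_inner inner_scaleR_left inner_scaleR_right
  by (simp add: field_simps)

lemma energy_has_derivative:
  assumes u: "(u has_vector_derivative u') (at t within T)" and pos: "dens (u t) > 0"
  shows "((\<lambda>s. dens (u s) * (norm (vel (u s)))\<^sup>2 / 2 + dens (u s) * \<phi>)
    has_real_derivative energy_deriv (u t) \<phi> u') (at t within T)"
proof -
  have bl: "bounded_linear dens" "bounded_linear momt"
    unfolding dens_def[abs_def] momt_def[abs_def]
    by (auto intro!: bounded_linear_compose[OF bounded_linear_fst] bounded_linear_intros)
  have \<rho>: "((\<lambda>s. dens (u s)) has_real_derivative dens u') (at t within T)"
    using bounded_linear.has_vector_derivative[OF bl(1) u]
    by (simp add: has_real_derivative_iff_has_vector_derivative)
  have m: "((\<lambda>s. momt (u s)) has_vector_derivative momt u') (at t within T)"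
    by (rule bounded_linear.has_vector_derivative[OF bl(2) u])
  have mm: "((\<lambda>s. momt (u s) \<bullet> momt (u s)) has_real_derivative 2 * (momt (u t) \<bullet> momt u'))
      (at t within T)"
    using bounded_bilinear.has_vector_derivative[OF bounded_bilinear_inner m m]
    by (simp add: has_real_derivative_iff_has_vector_derivative inner_commute)
  let ?\<rho> = "dens (u t)" and ?m = "momt (u t)"
  have "(2 * (?m \<bullet> momt u') * (2 * ?\<rho>) - ?m \<bullet> ?m * (2 * dens u')) / (2 * ?\<rho> * (2 * ?\<rho>))
      + dens u' * \<phi> = energy_deriv (u t) \<phi> u'"
    unfolding energy_deriv_def vel_def power2_norm_eq_inner inner_scaleR_left inner_scaleR_right
    using pos by (simp add: field_simps)
  with DERIV_add[OF DERIV_divide[OF mm DERIV_cmult[OF \<rho>, of 2]] DERIV_cmult_right[OF \<rho>, of \<phi>]] pos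
  show ?thesis unfolding kinetic_energy_momentum by simp
qed

lemma discrete_energy_derivative:
  assumes sol: "DGSEM_solution cl F M \<phi> T u" and t: "t \<in> T" and e: "e \<in> elems M"
  shows "((\<lambda>s. discrete_energy M \<phi> (u s) e) has_real_derivative
    (\<Sum>n\<in>nodes M. \<Sum>d\<in>UNIV. energy_deriv (u t e n) (\<phi> e n) (rhs cl F M \<phi> (u t) d e n)))
      (at t within T)"
  unfolding discrete_energy_def
proof (rule DERIV_sum)
  fix n assume n: "n \<in> nodes M"
  then obtain u' where u': "((\<lambda>s. u s e n) has_vector_derivative u') (at t within T)"
      "(jac M e n * vol_weight M n) *\<^sub>R u' = (\<Sum>d\<in>UNIV. rhs cl F M \<phi> (u t) d e n)"
    using sol t e unfolding DGSEM_solution_def by blast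
  have "e \<in> elems_and_neighbours M" using e by (simp add: elems_and_neighbours_def)
  then have "dens (u t e n) > 0" using sol t n unfolding DGSEM_solution_def by blast
  from DERIV_cmult[OF energy_has_derivative[OF u'(1) this], of "jac M e n * vol_weight M n" "\<phi> e n"]
  show "((\<lambda>s. jac M e n * vol_weight M n *
        (dens (u s e n) * (norm (vel (u s e n)))\<^sup>2 / 2 + dens (u s e n) * \<phi> e n))
      has_real_derivative
        (\<Sum>d\<in>UNIV. energy_deriv (u t e n) (\<phi> e n) (rhs cl F M \<phi> (u t) d e n))) (at t within T)"
    unfolding energy_deriv_linear(3)[symmetric] u'(2) energy_deriv_sum .
qed

theorem theorem6p3:
  fixes cl :: closure and F :: num_fluxes and rbar :: "real \<Rightarrow> real \<Rightarrow> real"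
  assumes "symmetric_mean rbar"
    and "symmetric_consistent cl (f_vol F)" and "symmetric_consistent cl (f_surf F)"
    and "density_flux_form rbar (f_vol F)" and "density_flux_form rbar (f_surf F)"
    and "noncons_form rbar (g_vol F)" and "noncons_form rbar (g_surf F)"
    and "KEP cl (f_vol F)" and "KEP cl (f_surf F)"
  shows "KPEP cl F"
  unfolding KPEP_def
proof (intro exI[of _ "energy_flux rbar"] conjI allI impI ballI)
  fix u u' :: state and \<phi> \<phi>' :: real and a :: "real^3"
  assume "dens u > 0" "dens u' > 0"
  then show "energy_flux rbar u \<phi> u' \<phi>' a = energy_flux rbar u' \<phi>' u \<phi> a"
    by (rule energy_flux_commute[OF assms(1)])
next
  fix M \<phi> T u t e
  assume mesh: "conforming_mesh M" and sol: "DGSEM_solution cl F M \<phi> T u"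
    and t: "t \<in> T" and e: "e \<in> elems M"
  have pos: "dens (u t e n) > 0" if "e \<in> elems_and_neighbours M" "n \<in> nodes M" for e n
    using sol t that unfolding DGSEM_solution_def by blast
  show "\<exists>E'. ((\<lambda>s. discrete_energy M \<phi> (u s) e) has_real_derivative E') (at t within T) \<and>
      E' + pressure_work cl M (u t) e = - interface_exchange (energy_flux rbar) M \<phi> (u t) e"
    using discrete_energy_derivative[OF sol t e]
      element_balance[OF assms(1,8,4,6,9,5,7) mesh e, of "u t"] pos by blast
qed

end
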